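(* Let $\{z^k\}$ be a sequence generated by the SCvx algorithm with $z^k\to\bar z$, and suppose that the linear independence constraint qualification (LICQ), the strict complementary slackness assumption, and the binding assumption are satisfied at $\bar z$. Then $$\|z^{k+1}-\bar z\|=o(\|z^k-\bar z\|)\qquad (k\to\infty).$$
   Context: **Original problem (P).** Let $n_x,n_u,N$ be positive integers (state dimension, control dimension, number of time steps) and $n_z=n_xN+n_u(N-1)$. (P) is the discrete-time optimal control problem written as: minimize $g_0(z)$ over $z\in\mathbb{R}^{n_z}$ subject to $g_i(z)=0$ for $i\in\mathcal I_{eq}=\{1,\dots,e\}$ (system dynamics), $g_i(z)\le 0$ for $i\in\mathcal I_{ineq}=\{e+1,\dots,p\}$, $h_j(z)\le 0$ for $j\in\mathcal J_{ineq}=\{1,\dots,q\}$. All $g_0,g_i,h_j:\mathbb{R}^{n_z}\to\mathbb{R}$ are continuously differentiable, the $h_j$ are convex, and the number of equality constraints satisfies $e\ge n_xN$. **Penalty function.** For fixed weights $\lambda_i\ge 0$, $\tau_j\ge0$, $$J(z)=g_0(z)+\sum_{i\in\mathcal I_{eq}}\lambda_i|g_i(z)|+\sum_{i\in\mathcal I_{ineq}}\lambda_i\max(0,g_i(z))+\sum_{j\in\mathcal J_{ineq}}\tau_j\max(0,h_j(z)).$$ **Linearized penalty function** at $z^k$: $$L^k(d)=g_0(z^k)+\nabla g_0(z^k)^Td+\sum_{i\in\mathcal I_{eq}}\lambda_i|g_i(z^k)+\nabla g_i(z^k)^Td|+\sum_{i\in\mathcal I_{ineq}}\lambda_i\max(0,g_i(z^k)+\nabla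 g_i(z^k)^Td)+\sum_{j\in\mathcal J_{ineq}}\tau_j\max(0,h_j(z^k)+\nabla h_j(z^k)^Td).$$ **SCvx algorithm.** Fix parameters $0<\rho_0<\rho_1<\rho_2<1$, $r_l>0$, $\alpha_{tr}>1$, $\beta_{tr}>1$, an initial point $z^1\in Z$ and radius $r^1>0$. At iteration $k$, given $(z^k,r^k)$: (1) compute an optimal solution $d$ of: minimize $L^k(d)$ subject to $\|d\|\le r^k$. (2) Set $\Delta J^k=J(z^k)-J(z^k+d)$ and $\Delta L^k=J(z^k)-L^k(d)$. If $\Delta L^k=0$, stop and return $z^k$; otherwise set $\rho^k=\Delta J^k/\Delta L^k$. (3) If $\rho^k<\rho_0$, reject the step: replace $r^k$ by $r^k/\alpha_{tr}$ and go back to (1) with the same $z^k$. Otherwise accept: $z^{k+1}=z^k+d$, and $r^{k+1}=r^k/\alpha_{tr}$ if $\rho^k<\rho_1$, $r^{k+1}=r^k$ if $\rho_1\le\rho^k<\rho_2$, $r^{k+1}=\beta_{tr}r^k$ if $\rho^k\ge\rho_2$; then replace $r^{k+1}$ by $\max\{r^{k+1},r_l\}$ and increase $k$ by one. If the algorithm stops at $z^k$, the sequence is continued constantly, $z^{l}=z^k$ for $l\ge k$. All iterates lie in a convex compact set $Z\subset\mathbb{R}^{n_z}$. **Active sets and LICQ.** $I_{ac}(\bar z)=\{i\in\mathcal I_{ineq}:g_i(\bar z)=0\}$, $J_{ac}(\bar z)=\{j\in\mathcal J_{ineq}:h_j(\bar z)=0\}$. LICQ holds at $\bar z$ if the vectors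 $\nabla g_i(\bar z)$ ($i\in\mathcal I_{eq}\cup I_{ac}(\bar z)$), $\nabla h_j(\bar z)$ ($j\in J_{ac}(\bar z)$) are linearly independent. **Strict complementary slackness.** $\bar z$ is a local optimum of (P) (in particular feasible), and there are multipliers $\bar\mu_i\in\mathbb{R}$ ($i\in\mathcal I_{eq}$), $\bar\mu_i\ge0$ ($i\in\mathcal I_{ineq}$), $\bar\sigma_j\ge0$ ($j\in\mathcal J_{ineq}$) with $$\nabla g_0(\bar z)+\sum_{i\in\mathcal I_{eq}}\bar\mu_i\nabla g_i(\bar z)+\sum_{i\in I_{ac}(\bar z)}\bar\mu_i\nabla g_i(\bar z)+\sum_{j\in J_{ac}(\bar z)}\bar\sigma_j\nabla h_j(\bar z)=0,$$ and moreover $\bar\mu_i>0$ for all $i\in I_{ac}(\bar z)$ and $\bar\sigma_j>0$ for all $j\in J_{ac}(\bar z)$. **Exact penalty weights (standing).** The weights are sufficiently large: $\lambda_i>|\bar\mu_i|$ for all $i\in\mathcal I_{eq}\cup\mathcal I_{ineq}$ and $\tau_j>|\bar\sigma_j|$ for all $j\in\mathcal J_{ineq}$ (multipliers of inactive constraints may be taken as $0$). **Binding assumption.** $|I_{ac}(\bar z)|+|J_{ac}(\bar z)|\ge n_u(N-1)$. *)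

theory Defs
  imports "HOL-Analysis.Analysis" "HOL-Library.Landau_Symbols"
begin

definition gradient :: "('a::real_inner \<Rightarrow> real) \<Rightarrow> 'a \<Rightarrow> 'a" where
  "gradient f x = (THE D. GDERIV f x :> D)"

definition continuously_differentiable :: "('a::real_inner \<Rightarrow> real) \<Rightarrow> bool" where
  "continuously_differentiable f \<longleftrightarrow>
     (\<forall>x. \<exists>D. GDERIV f x :> D) \<and> continuous_on UNIV (gradient f)"

lemma gradient_eqI:
  fixes f :: "'a::real_inner \<Rightarrow> real"
  assumes "GDERIV f x :> D"
  shows "gradient f x = D"
  unfolding gradient_def
proof (rule the_equality)
  fix D' assume "GDERIV f x :> D'"
  with assms have "(\<lambda>h. inner h D') = (\<lambda>h. inner h D)"
    unfolding gderiv_def by (metis has_derivative_unique)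
  then have "inner (D' - D) D' = inner (D' - D) D" by metis
  then have "inner (D' - D) (D' - D) = 0" by (simp add: inner_diff_right)
  then show "D' = D" by simp
qed (fact assms)

text \<open>
  \<open>neq\<close>, \<open>ng\<close> and \<open>nh\<close> are the numbers \<open>e\<close>, \<open>p\<close> and \<open>q\<close>. The functions \<open>g_i\<close> and \<open>h_j\<close> are
  indexed by natural numbers; \<open>gfun P 0\<close> is the objective, and values at indices outside
  \<open>{0..ng}\<close> (respectively \<open>{1..nh}\<close>) are irrelevant.
\<close>

record ('n::finite) ocp =
  nx :: nat
  nu :: nat
  horizon :: nat
  neq :: nat
  ng :: nat
  nh :: nat
  gfun :: "nat \<Rightarrow> real^'n \<Rightarrow> real"
  hfun :: "nat \<Rightarrow> real^'n \<Rightarrow> real"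

definition I_eq :: "('n::finite) ocp \<Rightarrow> nat set" where
  "I_eq P = {1..neq P}"

definition I_ineq :: "('n::finite) ocp \<Rightarrow> nat set" where
  "I_ineq P = {neq P + 1..ng P}"

definition J_ineq :: "('n::finite) ocp \<Rightarrow> nat set" where
  "J_ineq P = {1..nh P}"

definition valid_ocp :: "('n::finite) ocp \<Rightarrow> bool" where
  "valid_ocp P \<longleftrightarrow>
     nx P > 0 \<and> nu P > 0 \<and> horizon P > 0 \<and>
     CARD('n) = nx P * horizon P + nu P * (horizon P - 1) \<and>
     neq P \<ge> nx P * horizon P \<and>
     (\<forall>i \<in> insert 0 (I_eq P \<union> I_ineq P). continuously_differentiable (gfun P i)) \<and>
     (\<forall>j \<in> J_ineq P. continuously_differentiable (hfun P j) \<and> convex_on UNIV (hfun P j))"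

definition feasible :: "('n::finite) ocp \<Rightarrow> (real^'n) set" where
  "feasible P = {z. (\<forall>i \<in> I_eq P. gfun P i z = 0) \<and> (\<forall>i \<in> I_ineq P. gfun P i z \<le> 0) \<and>
                    (\<forall>j \<in> J_ineq P. hfun P j z \<le> 0)}"

definition local_optimum :: "('n::finite) ocp \<Rightarrow> real^'n \<Rightarrow> bool" where
  "local_optimum P zb \<longleftrightarrow> zb \<in> feasible P \<and>
     (\<exists>\<epsilon>>0. \<forall>z \<in> feasible P \<inter> ball zb \<epsilon>. gfun P 0 zb \<le> gfun P 0 z)"

definition I_ac :: "('n::finite) ocp \<Rightarrow> real^'n \<Rightarrow> nat set" where
  "I_ac P zb = {i \<in> I_ineq P. gfun P i zb = 0}"

definition J_ac :: "('n::finite) ocp \<Rightarrow> real^'n \<Rightarrow> nat set" where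
  "J_ac P zb = {j \<in> J_ineq P. hfun P j zb = 0}"

text \<open>
  Linear independence is that of the indexed family of gradients (over the disjoint sum of the two
  index sets), so repeated gradients are excluded by injectivity.
\<close>

definition licq :: "('n::finite) ocp \<Rightarrow> real^'n \<Rightarrow> bool" where
  "licq P zb \<longleftrightarrow>
     (let S = (I_eq P \<union> I_ac P zb) <+> J_ac P zb;
          G = case_sum (\<lambda>i. gradient (gfun P i) zb) (\<lambda>j. gradient (hfun P j) zb)
      in inj_on G S \<and> independent (G ` S))"

definition strict_complementary_slackness ::
    "('n::finite) ocp \<Rightarrow> real^'n \<Rightarrow> (nat \<Rightarrow> real) \<Rightarrow> (nat \<Rightarrow> real) \<Rightarrow> bool" where
  "strict_complementary_slackness P zb \<mu> \<sigma> \<longleftrightarrow>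
     local_optimum P zb \<and>
     (\<forall>i \<in> I_ineq P. \<mu> i \<ge> 0) \<and> (\<forall>j \<in> J_ineq P. \<sigma> j \<ge> 0) \<and>
     gradient (gfun P 0) zb
       + (\<Sum>i \<in> I_eq P. \<mu> i *\<^sub>R gradient (gfun P i) zb)
       + (\<Sum>i \<in> I_ac P zb. \<mu> i *\<^sub>R gradient (gfun P i) zb)
       + (\<Sum>j \<in> J_ac P zb. \<sigma> j *\<^sub>R gradient (hfun P j) zb) = 0 \<and>
     (\<forall>i \<in> I_ac P zb. \<mu> i > 0) \<and> (\<forall>j \<in> J_ac P zb. \<sigma> j > 0)"

definition binding :: "('n::finite) ocp \<Rightarrow> real^'n \<Rightarrow> bool" where
  "binding P zb \<longleftrightarrow> card (I_ac P zb) + card (J_ac P zb) \<ge> nu P * (horizon P - 1)"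

definition penalty ::
    "('n::finite) ocp \<Rightarrow> (nat \<Rightarrow> real) \<Rightarrow> (nat \<Rightarrow> real) \<Rightarrow> real^'n \<Rightarrow> real" where
  "penalty P lam \<tau> z =
     gfun P 0 z
     + (\<Sum>i \<in> I_eq P. lam i * \<bar>gfun P i z\<bar>)
     + (\<Sum>i \<in> I_ineq P. lam i * max 0 (gfun P i z))
     + (\<Sum>j \<in> J_ineq P. \<tau> j * max 0 (hfun P j z))"

definition linearization :: "(real^('n::finite) \<Rightarrow> real) \<Rightarrow> real^'n \<Rightarrow> real^'n \<Rightarrow> real" where
  "linearization f z d = f z + gradient f z \<bullet> d"

definition lin_penalty ::
    "('n::finite) ocp \<Rightarrow> (nat \<Rightarrow> real) \<Rightarrow> (nat \<Rightarrow> real) \<Rightarrow> real^'n \<Rightarrow> real^'n \<Rightarrow> real" where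
  "lin_penalty P lam \<tau> z d =
     linearization (gfun P 0) z d
     + (\<Sum>i \<in> I_eq P. lam i * \<bar>linearization (gfun P i) z d\<bar>)
     + (\<Sum>i \<in> I_ineq P. lam i * max 0 (linearization (gfun P i) z d))
     + (\<Sum>j \<in> J_ineq P. \<tau> j * max 0 (linearization (hfun P j) z d))"

record scvx_params =
  rho0 :: real
  rho1 :: real
  rho2 :: real
  rl :: real
  alpha_tr :: real
  beta_tr :: real

definition valid_params :: "scvx_params \<Rightarrow> bool" where
  "valid_params A \<longleftrightarrow> 0 < rho0 A \<and> rho0 A < rho1 A \<and> rho1 A < rho2 A \<and> rho2 A < 1 \<and>
     rl A > 0 \<and> alpha_tr A > 1 \<and> beta_tr A > 1"

definition subproblem_solution ::
    "('n::finite) ocp \<Rightarrow> (nat \<Rightarrow> real) \<Rightarrow> (nat \<Rightarrow> real) \<Rightarrow> real^'n \<Rightarrow> real \<Rightarrow> real^'n \<Rightarrow> bool" where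
  "subproblem_solution P lam \<tau> z r d \<longleftrightarrow>
     is_arg_min (lin_penalty P lam \<tau> z) (\<lambda>d. norm d \<le> r) d"

definition actual_decrease ::
    "('n::finite) ocp \<Rightarrow> (nat \<Rightarrow> real) \<Rightarrow> (nat \<Rightarrow> real) \<Rightarrow> real^'n \<Rightarrow> real^'n \<Rightarrow> real" where
  "actual_decrease P lam \<tau> z d = penalty P lam \<tau> z - penalty P lam \<tau> (z + d)"

definition predicted_decrease ::
    "('n::finite) ocp \<Rightarrow> (nat \<Rightarrow> real) \<Rightarrow> (nat \<Rightarrow> real) \<Rightarrow> real^'n \<Rightarrow> real^'n \<Rightarrow> real" where
  "predicted_decrease P lam \<tau> z d = penalty P lam \<tau> z - lin_penalty P lam \<tau> z d"

definition decrease_ratio ::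
    "('n::finite) ocp \<Rightarrow> (nat \<Rightarrow> real) \<Rightarrow> (nat \<Rightarrow> real) \<Rightarrow> real^'n \<Rightarrow> real^'n \<Rightarrow> real" where
  "decrease_ratio P lam \<tau> z d = actual_decrease P lam \<tau> z d / predicted_decrease P lam \<tau> z d"

text \<open>
  \<open>scvx_radius P lam \<tau> A z r s\<close>: started at \<open>z\<close> with radius \<open>r\<close>, the trust-region radius can become
  \<open>s\<close> after finitely many (possibly no) rejected steps at the same \<open>z\<close>. Subproblem
  solutions need not be unique; each attempt may use any of them.
\<close>

inductive scvx_radius ::
    "('n::finite) ocp \<Rightarrow> (nat \<Rightarrow> real) \<Rightarrow> (nat \<Rightarrow> real) \<Rightarrow> scvx_params \<Rightarrow> real^'n \<Rightarrow> real \<Rightarrow> real \<Rightarrow> bool"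
  for P lam \<tau> A z r where
  start: "scvx_radius P lam \<tau> A z r r"
| reject: "\<lbrakk> scvx_radius P lam \<tau> A z r s; subproblem_solution P lam \<tau> z s d;
             predicted_decrease P lam \<tau> z d \<noteq> 0; decrease_ratio P lam \<tau> z d < rho0 A \<rbrakk>
           \<Longrightarrow> scvx_radius P lam \<tau> A z r (s / alpha_tr A)"

definition updated_radius :: "scvx_params \<Rightarrow> real \<Rightarrow> real \<Rightarrow> real" where
  "updated_radius A s \<rho> =
     max (if \<rho> < rho1 A then s / alpha_tr A else if \<rho> < rho2 A then s else beta_tr A * s) (rl A)"

definition scvx_accept ::
    "('n::finite) ocp \<Rightarrow> (nat \<Rightarrow> real) \<Rightarrow> (nat \<Rightarrow> real) \<Rightarrow> scvx_params \<Rightarrow>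
     real^'n \<Rightarrow> real \<Rightarrow> real^'n \<Rightarrow> real \<Rightarrow> bool" where
  "scvx_accept P lam \<tau> A z r z' r' \<longleftrightarrow>
     (\<exists>s d. scvx_radius P lam \<tau> A z r s \<and> subproblem_solution P lam \<tau> z s d \<and>
            predicted_decrease P lam \<tau> z d \<noteq> 0 \<and> decrease_ratio P lam \<tau> z d \<ge> rho0 A \<and>
            z' = z + d \<and> r' = updated_radius A s (decrease_ratio P lam \<tau> z d))"

definition scvx_stop ::
    "('n::finite) ocp \<Rightarrow> (nat \<Rightarrow> real) \<Rightarrow> (nat \<Rightarrow> real) \<Rightarrow> scvx_params \<Rightarrow> real^'n \<Rightarrow> real \<Rightarrow> bool" where
  "scvx_stop P lam \<tau> A z r \<longleftrightarrow>
     (\<exists>s d. scvx_radius P lam \<tau> A z r s \<and> subproblem_solution P lam \<tau> z s d \<and>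
            predicted_decrease P lam \<tau> z d = 0)"

text \<open>
  Sequences start at index 1, so \<open>z 0\<close> is arbitrary. The two disjuncts are a run that never stops
  and a run that stops at iteration \<open>K\<close> and is continued constantly.
\<close>

definition scvx_sequence ::
    "('n::finite) ocp \<Rightarrow> (nat \<Rightarrow> real) \<Rightarrow> (nat \<Rightarrow> real) \<Rightarrow> scvx_params \<Rightarrow> (nat \<Rightarrow> real^'n) \<Rightarrow> bool" where
  "scvx_sequence P lam \<tau> A z \<longleftrightarrow>
     (\<exists>r::nat \<Rightarrow> real. r 1 > 0 \<and>
        ((\<forall>k\<ge>1. scvx_accept P lam \<tau> A (z k) (r k) (z (Suc k)) (r (Suc k))) \<or>
         (\<exists>K\<ge>1. (\<forall>k\<in>{1..<K}. scvx_accept P lam \<tau> A (z k) (r k) (z (Suc k)) (r (Suc k))) \<and>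
                scvx_stop P lam \<tau> A (z K) (r K) \<and> (\<forall>l\<ge>K. z l = z K))))"

end

theory Submission
  imports Defs
begin

text \<open>
  LICQ and the binding assumption force the gradients of the active constraints at the limit to
  form a basis, so the linearised active constraints have a unique common root \<open>d\<close> near the limit:
  the Newton step for the square system of active constraints, which converges superlinearly.
  Strict complementarity and the strict bounds on the weights make the linearised penalty grow at
  least linearly away from \<open>d\<close>, so \<open>d\<close> solves every subproblem whose trust region contains it.
  The predicted decrease is therefore of order \<open>norm d\<close>, while the penalty and its linearisation
  differ by \<open>o(norm d)\<close>; the ratio test cannot fail, and since the radius is reset to at least
  \<open>rl A\<close>, every late accepted step is the full Newton step.
\<close>

section \<open>First-order estimates near a point\<close>

lemma continuously_differentiable_GDERIV:
  "continuously_differentiable f \<Longrightarrow> GDERIV f x :> gradient f x"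
  unfolding continuously_differentiable_def by (metis gradient_eqI)

lemma continuously_differentiable_tendsto_gradient:
  assumes "continuously_differentiable f"
  shows "(gradient f \<longlongrightarrow> gradient f x) (nhds x)"
  using assms unfolding continuously_differentiable_def
  by (simp add: continuous_on_eq_continuous_at isCont_def tendsto_at_iff_tendsto_nhds)

lemma continuously_differentiable_tendsto:
  assumes "continuously_differentiable f"
  shows "(f \<longlongrightarrow> f x) (nhds x)"
proof -
  have "isCont f x"
    using continuously_differentiable_GDERIV[OF assms, of x] has_derivative_continuous
    unfolding gderiv_def by blast
  then show ?thesis by (simp add: isCont_def tendsto_at_iff_tendsto_nhds)
qed

text \<open>Continuity of the gradient at \<open>p\<close> keeps any two gradients in a small ball
  within \<open>e\<close> of each other, and the mean value inequality turns this into an error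
  bound. Both endpoints may move: the Newton analysis takes \<open>y = p\<close>, the model error
  takes \<open>y = x + d\<close>.\<close>

lemma continuously_differentiable_strict:
  fixes f :: "'a::real_inner \<Rightarrow> real"
  assumes f: "continuously_differentiable f" and e: "e > 0"
  obtains \<delta> where "\<delta> > 0"
    "\<And>x y. x \<in> ball p \<delta> \<Longrightarrow> y \<in> ball p \<delta> \<Longrightarrow>
       \<bar>f y - (f x + gradient f x \<bullet> (y - x))\<bar> \<le> e * norm (y - x)"
proof -
  have "\<forall>\<^sub>F x in nhds p. dist (gradient f x) (gradient f p) < e / 2"
    using tendstoD[OF continuously_differentiable_tendsto_gradient[OF f] half_gt_zero[OF e]] .
  then obtain \<delta> where \<delta>: "\<delta> > 0"
    and close: "\<And>x. dist x p < \<delta> \<Longrightarrow> dist (gradient f x) (gradient f p) < e / 2"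
    unfolding eventually_nhds_metric by blast
  show ?thesis
  proof (rule that[OF \<delta>])
    fix x y assume x: "x \<in> ball p \<delta>" and y: "y \<in> ball p \<delta>"
    \<comment> \<open>The mean value inequality is applied to \<open>f\<close> minus its linear part
      at \<open>x\<close>, whose derivative at \<open>u\<close> is the difference of the gradients
      at \<open>u\<close> and \<open>x\<close>.\<close>
    have "norm ((f y - y \<bullet> gradient f x) - (f x - x \<bullet> gradient f x)) \<le> e * norm (y - x)"
    proof (rule differentiable_bound[of "ball p \<delta>" _ "\<lambda>u h. h \<bullet> gradient f u - h \<bullet> gradient f x"])
      fix u assume u: "u \<in> ball p \<delta>"
      show "((\<lambda>u. f u - u \<bullet> gradient f x) has_derivative
              (\<lambda>h. h \<bullet> gradient f u - h \<bullet> gradient f x)) (at u within ball p \<delta>)"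
        using continuously_differentiable_GDERIV[OF f, of u] unfolding gderiv_def
        by (auto intro!: derivative_eq_intros intro: has_derivative_at_withinI)
      have "norm (gradient f u - gradient f x) \<le> e"
        using close[of u] close[of x] u x
        by (metis dist_commute dist_norm dist_triangle_half_l less_imp_le mem_ball)
      then have "\<bar>h \<bullet> (gradient f u - gradient f x)\<bar> \<le> e * norm h" for h
        using Cauchy_Schwarz_ineq2[of h "gradient f u - gradient f x"]
        by (metis mult.commute mult_left_mono norm_ge_zero order_trans)
      then show "onorm (\<lambda>h. h \<bullet> gradient f u - h \<bullet> gradient f x) \<le> e"
        using e by (intro onorm_bound) (auto simp: inner_diff_right)
    qed (use x y in auto)
    then show "\<bar>f y - (f x + gradient f x \<bullet> (y - x))\<bar> \<le> e * norm (y - x)"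
      by (simp add: algebra_simps inner_diff_right inner_commute)
  qed
qed

section \<open>Sharp vertices: an abstract exact penalty and its active gradients\<close>

text \<open>
  An exact penalty written as \<open>f0 + (\<Sum>a\<in>A. w a \<circ> f a)\<close>, with \<open>S\<close> the indices of the constraints active
  at \<open>p\<close>, multipliers \<open>m\<close>, and \<open>c a\<close> the margin by which
  the slopes of \<open>w a\<close> at \<open>0\<close> dominate \<open>m a\<close>.
\<close>

locale sharp_vertex =
  fixes f0 :: "'a::euclidean_space \<Rightarrow> real"
    and f :: "'i \<Rightarrow> 'a \<Rightarrow> real"
    and w :: "'i \<Rightarrow> real \<Rightarrow> real"
    and A S :: "'i set"
    and m c C :: "'i \<Rightarrow> real"
    and p :: 'a
  assumes finite_A: "finite A" and S_subset: "S \<subseteq> A"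
    and f0_diff: "continuously_differentiable f0"
    and f_diff: "a \<in> A \<Longrightarrow> continuously_differentiable (f a)"
    and active: "a \<in> S \<Longrightarrow> f a p = 0"
    and inactive: "a \<in> A - S \<Longrightarrow> f a p < 0"
    and w_lipschitz: "a \<in> A \<Longrightarrow> \<bar>w a s - w a t\<bar> \<le> C a * \<bar>s - t\<bar>"
    and C_nonneg: "a \<in> A \<Longrightarrow> C a \<ge> 0"
    and c_pos: "a \<in> S \<Longrightarrow> c a > 0"
    and w_growth: "a \<in> S \<Longrightarrow> w a 0 + m a * t + c a * \<bar>t\<bar> \<le> w a t"
    and w_inactive: "a \<in> A - S \<Longrightarrow> s \<le> 0 \<Longrightarrow> w a s \<le> w a t"
    and stationary: "gradient f0 p + (\<Sum>a\<in>S. m a *\<^sub>R gradient (f a) p) = 0"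
    and inj_gradients: "inj_on (\<lambda>a. gradient (f a) p) S"
    and independent_gradients: "independent ((\<lambda>a. gradient (f a) p) ` S)"
    and card_S: "card S \<ge> DIM('a)"
begin

definition merit :: "'a \<Rightarrow> real" where
  "merit x = f0 x + (\<Sum>a\<in>A. w a (f a x))"

definition model :: "'a \<Rightarrow> 'a \<Rightarrow> real" where
  "model x d = f0 x + gradient f0 x \<bullet> d + (\<Sum>a\<in>A. w a (f a x + gradient (f a) x \<bullet> d))"

text \<open>A relation rather than a function: a solution is only shown to exist where the active
  gradients still span the space, that is, for \<open>x\<close> near \<open>p\<close>.\<close>

definition newton_step :: "'a \<Rightarrow> 'a \<Rightarrow> bool" where
  "newton_step x d \<longleftrightarrow> (\<forall>a\<in>S. f a x + gradient (f a) x \<bullet> d = 0)"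

lemma finite_S: "finite S"
  using S_subset finite_A finite_subset by blast

lemma f_diff_S: "a \<in> S \<Longrightarrow> continuously_differentiable (f a)"
  using S_subset f_diff by blast

text \<open>Independence bounds the number of active constraints by the dimension, so the lower
  bound \<open>card_S\<close> is attained and the Newton system is square.\<close>

lemma card_S_eq: "card S = DIM('a)"
  using card_S independent_bound[OF independent_gradients] card_image[OF inj_gradients] by simp

lemma span_gradients: "span ((\<lambda>a. gradient (f a) p) ` S) = UNIV"
proof -
  have "UNIV \<subseteq> span ((\<lambda>a. gradient (f a) p) ` S)"
    using independent_gradients card_S card_image[OF inj_gradients]
    by (intro card_ge_dim_independent) auto
  then show ?thesis by blast
qed

text \<open>A vector orthogonal to all active gradients is orthogonal to their span, hence to
  itself. So the weighted sum is positive off \<open>0\<close>; its minimum over the compact unit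
  sphere serves as \<open>\<kappa>\<close>, and homogeneity extends the bound to all
  \<open>v\<close>.\<close>

lemma vertex_slope:
  obtains \<kappa> where "\<kappa> > 0" "\<And>v. \<kappa> * norm v \<le> (\<Sum>a\<in>S. c a * \<bar>gradient (f a) p \<bullet> v\<bar>)"
proof -
  define \<phi> where "\<phi> v = (\<Sum>a\<in>S. c a * \<bar>gradient (f a) p \<bullet> v\<bar>)" for v
  have nonneg: "0 \<le> c a * \<bar>gradient (f a) p \<bullet> v\<bar>" if "a \<in> S" for a v
    using c_pos[OF that] by simp
  have pos: "\<phi> v > 0" if "v \<noteq> 0" for v
  proof (rule ccontr)
    assume "\<not> \<phi> v > 0"
    then have "\<phi> v = 0"
      unfolding \<phi>_def using nonneg by (metis (no_types, lifting) less_eq_real_def sum_nonneg)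
    then have "\<forall>a\<in>S. c a * \<bar>gradient (f a) p \<bullet> v\<bar> = 0"
      unfolding \<phi>_def using nonneg finite_S by (subst (asm) sum_nonneg_eq_0_iff) auto
    then have "\<forall>a\<in>S. gradient (f a) p \<bullet> v = 0"
      using c_pos by force
    then have "orthogonal v y" if "y \<in> (\<lambda>a. gradient (f a) p) ` S" for y
      using that by (auto simp: orthogonal_def inner_commute)
    then have "orthogonal v v"
      using orthogonal_to_span[of v "(\<lambda>a. gradient (f a) p) ` S" v] span_gradients by auto
    with that show False by (simp add: orthogonal_def)
  qed
  have cont: "continuous_on (sphere 0 1) \<phi>"
    unfolding \<phi>_def by (intro continuous_intros)
  obtain b :: 'a where "b \<in> Basis" by (meson nonempty_Basis ex_in_conv)
  then have "sphere (0::'a) 1 \<noteq> {}" by force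
  then obtain u where u: "u \<in> sphere 0 1" "\<And>v. v \<in> sphere 0 1 \<Longrightarrow> \<phi> u \<le> \<phi> v"
    using continuous_attains_inf[OF compact_sphere _ cont] by metis
  show ?thesis
  proof (rule that)
    show "\<phi> u > 0" using u(1) by (intro pos) auto
    fix v :: 'a
    show "\<phi> u * norm v \<le> (\<Sum>a\<in>S. c a * \<bar>gradient (f a) p \<bullet> v\<bar>)"
    proof (cases "v = 0")
      case False
      have "\<phi> u \<le> \<phi> (v /\<^sub>R norm v)"
        using False by (intro u(2)) simp
      also have "\<dots> = \<phi> v / norm v"
        unfolding \<phi>_def by (simp add: sum_distrib_left abs_mult divide_inverse mult_ac)
      finally show ?thesis
        using False by (simp add: \<phi>_def field_simps)
    qed simp
  qed
qed

text \<open>Both bounds hold at \<open>p\<close> by \<open>vertex_slope\<close> and survive a small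
  perturbation of the gradients with half the constant. The first makes the Newton system solvable
  and stable; the second drives the growth of the model.\<close>

lemma sharp_gradients:
  obtains \<kappa> where "\<kappa> > 0"
    "\<forall>\<^sub>F x in nhds p. \<forall>v. \<kappa> * norm v \<le> (\<Sum>a\<in>S. c a * \<bar>gradient (f a) x \<bullet> v\<bar>)"
    "\<forall>\<^sub>F x in nhds p. \<forall>v. \<kappa> * norm v \<le> gradient f0 x \<bullet> v +
       (\<Sum>a\<in>S. m a * (gradient (f a) x \<bullet> v) + c a * \<bar>gradient (f a) x \<bullet> v\<bar>)"
proof -
  obtain \<kappa> where \<kappa>: "\<kappa> > 0" "\<And>v. \<kappa> * norm v \<le> (\<Sum>a\<in>S. c a * \<bar>gradient (f a) p \<bullet> v\<bar>)"
    using vertex_slope by blast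
  \<comment> \<open>The factor \<open>\<bar>m a\<bar> + c a\<close> is a Lipschitz constant of
    \<open>m a * t + c a * \<bar>t\<bar>\<close> in \<open>t\<close>, so
    \<open>\<epsilon> x * norm v\<close> bounds the loss in either estimate when the gradients move
    from \<open>p\<close> to \<open>x\<close>.\<close>
  define \<epsilon> where "\<epsilon> x = norm (gradient f0 x - gradient f0 p) +
    (\<Sum>a\<in>S. (\<bar>m a\<bar> + c a) * norm (gradient (f a) x - gradient (f a) p))" for x
  have "(\<epsilon> \<longlongrightarrow> norm (gradient f0 p - gradient f0 p) +
      (\<Sum>a\<in>S. (\<bar>m a\<bar> + c a) * norm (gradient (f a) p - gradient (f a) p))) (nhds p)"
    unfolding \<epsilon>_def
    by (intro tendsto_intros continuously_differentiable_tendsto_gradient f0_diff f_diff_S)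
  then have "(\<epsilon> \<longlongrightarrow> 0) (nhds p)" by simp
  then have small: "\<forall>\<^sub>F x in nhds p. \<epsilon> x < \<kappa> / 2"
    using \<kappa>(1) by (intro order_tendstoD) auto
  have step: "\<bar>gradient (f a) x \<bullet> v - gradient (f a) p \<bullet> v\<bar>
      \<le> norm (gradient (f a) x - gradient (f a) p) * norm v" for a x v
    by (metis Cauchy_Schwarz_ineq2 inner_diff_left)
  have slope: "\<kappa> / 2 * norm v \<le> (\<Sum>a\<in>S. c a * \<bar>gradient (f a) x \<bullet> v\<bar>)"
    if x: "\<epsilon> x < \<kappa> / 2" for x v
  proof -
    have "c a * \<bar>gradient (f a) p \<bullet> v\<bar> \<le> c a * \<bar>gradient (f a) x \<bullet> v\<bar> +
        (\<bar>m a\<bar> + c a) * norm (gradient (f a) x - gradient (f a) p) * norm v" if "a \<in> S" for a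
    proof -
      have "c a * \<bar>gradient (f a) p \<bullet> v\<bar> \<le> c a * (\<bar>gradient (f a) x \<bullet> v\<bar> +
          norm (gradient (f a) x - gradient (f a) p) * norm v)"
        using c_pos[OF that] step[of a x v] by (intro mult_left_mono) auto
      also have "\<dots> \<le> c a * \<bar>gradient (f a) x \<bullet> v\<bar> +
        (\<bar>m a\<bar> + c a) * norm (gradient (f a) x - gradient (f a) p) * norm v"
        by (simp add: algebra_simps)
      finally show ?thesis .
    qed
    then have "(\<Sum>a\<in>S. c a * \<bar>gradient (f a) p \<bullet> v\<bar>) \<le>
        (\<Sum>a\<in>S. c a * \<bar>gradient (f a) x \<bullet> v\<bar> +
        (\<bar>m a\<bar> + c a) * norm (gradient (f a) x - gradient (f a) p) * norm v)"
      by (intro sum_mono)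
    also have "\<dots> \<le> (\<Sum>a\<in>S. c a * \<bar>gradient (f a) x \<bullet> v\<bar>) + \<epsilon> x * norm v"
      unfolding \<epsilon>_def by (simp add: sum.distrib sum_distrib_left algebra_simps)
    also have "\<epsilon> x * norm v \<le> \<kappa> / 2 * norm v"
      using x by (intro mult_right_mono) auto
    finally show ?thesis using \<kappa>(2)[of v] by simp
  qed
  have growth: "\<kappa> / 2 * norm v \<le> gradient f0 x \<bullet> v +
       (\<Sum>a\<in>S. m a * (gradient (f a) x \<bullet> v) + c a * \<bar>gradient (f a) x \<bullet> v\<bar>)"
    if x: "\<epsilon> x < \<kappa> / 2" for x v
  proof -
    \<comment> \<open>Stationarity cancels the linear terms at \<open>p\<close>; only the absolute
      values remain, and these are bounded below by \<open>\<kappa>\<close>.\<close>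
    have "gradient f0 p \<bullet> v + (\<Sum>a\<in>S. m a * (gradient (f a) p \<bullet> v)) = 0"
      using arg_cong[OF stationary, of "\<lambda>u. u \<bullet> v"] by (simp add: inner_add_left inner_sum_left)
    then have "\<kappa> * norm v \<le> gradient f0 p \<bullet> v +
        (\<Sum>a\<in>S. m a * (gradient (f a) p \<bullet> v) + c a * \<bar>gradient (f a) p \<bullet> v\<bar>)"
      using \<kappa>(2)[of v] by (simp add: sum.distrib)
    moreover have "gradient f0 p \<bullet> v \<le>
        gradient f0 x \<bullet> v + norm (gradient f0 x - gradient f0 p) * norm v"
      using Cauchy_Schwarz_ineq2[of "gradient f0 x - gradient f0 p" v]
      by (simp add: inner_diff_left)
    moreover have "(\<Sum>a\<in>S. m a * (gradient (f a) p \<bullet> v) + c a * \<bar>gradient (f a) p \<bullet> v\<bar>) \<le>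
        (\<Sum>a\<in>S. (m a * (gradient (f a) x \<bullet> v) + c a * \<bar>gradient (f a) x \<bullet> v\<bar>) +
          (\<bar>m a\<bar> + c a) * norm (gradient (f a) x - gradient (f a) p) * norm v)"
    proof (rule sum_mono)
      fix a assume a: "a \<in> S"
      define s t D where "s = gradient (f a) p \<bullet> v" and "t = gradient (f a) x \<bullet> v"
        and "D = norm (gradient (f a) x - gradient (f a) p) * norm v"
      have D: "\<bar>t - s\<bar> \<le> D" using step[of a x v] by (simp add: s_def t_def D_def)
      have "m a * (s - t) \<le> \<bar>m a\<bar> * \<bar>s - t\<bar>" by (metis abs_ge_self abs_mult)
      also have "\<dots> \<le> \<bar>m a\<bar> * D" using D by (intro mult_left_mono) auto
      finally have "m a * (s - t) \<le> \<bar>m a\<bar> * D" .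
      moreover have "c a * (\<bar>s\<bar> - \<bar>t\<bar>) \<le> c a * D"
        using c_pos[OF a] D by (intro mult_left_mono) auto
      ultimately have "m a * s + c a * \<bar>s\<bar> \<le> (m a * t + c a * \<bar>t\<bar>) + (\<bar>m a\<bar> + c a) * D"
        by (simp add: algebra_simps)
      then show "m a * (gradient (f a) p \<bullet> v) + c a * \<bar>gradient (f a) p \<bullet> v\<bar> \<le>
        (m a * (gradient (f a) x \<bullet> v) + c a * \<bar>gradient (f a) x \<bullet> v\<bar>) +
          (\<bar>m a\<bar> + c a) * norm (gradient (f a) x - gradient (f a) p) * norm v"
        by (simp add: s_def t_def D_def mult.assoc)
    qed
    moreover have "norm (gradient f0 x - gradient f0 p) * norm v +
        (\<Sum>a\<in>S. (\<bar>m a\<bar> + c a) * norm (gradient (f a) x - gradient (f a) p) * norm v) =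
        \<epsilon> x * norm v"
      unfolding \<epsilon>_def by (simp add: sum_distrib_right distrib_right)
    moreover have "\<epsilon> x * norm v \<le> \<kappa> / 2 * norm v"
      using x by (intro mult_right_mono) auto
    ultimately show ?thesis by (simp add: sum.distrib)
  qed
  show ?thesis
  proof (rule that[of "\<kappa> / 2"])
    show "\<kappa> / 2 > 0" using \<kappa>(1) by simp
  qed (use small slope growth in \<open>auto elim!: eventually_mono\<close>)
qed

section \<open>The Newton step for the active constraints\<close>

text \<open>The slope bound leaves no nonzero vector orthogonal to all active gradients at
  \<open>x\<close>, so they span; as their number is the dimension, they form a basis and every
  right-hand side is attained.\<close>

lemma newton_step_exists:
  assumes "\<kappa> > 0" and slope: "\<And>v. \<kappa> * norm v \<le> (\<Sum>a\<in>S. c a * \<bar>gradient (f a) x \<bullet> v\<bar>)"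
  obtains d where "newton_step x d"
proof -
  let ?G = "\<lambda>a. gradient (f a) x"
  have span: "span (?G ` S) = UNIV"
  proof (rule ccontr)
    assume "span (?G ` S) \<noteq> UNIV"
    then obtain v where v: "v \<noteq> 0" "\<And>y. y \<in> span (?G ` S) \<Longrightarrow> orthogonal v y"
      using orthogonal_to_subspace_exists_gen[of "?G ` S" UNIV] by (auto simp: top.not_eq_extremum)
    have "gradient (f a) x \<bullet> v = 0" if "a \<in> S" for a
      using v(2)[OF span_base, of "?G a"] that by (simp add: orthogonal_def inner_commute)
    then have "\<kappa> * norm v \<le> 0" using slope[of v] by simp
    with v(1) \<open>\<kappa> > 0\<close> show False by (simp add: mult_le_0_iff)
  qed
  \<comment> \<open>A spanning set has at least as many elements as the dimension, which is
    \<open>card S\<close>; hence no two indices share a gradient.\<close>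
  have "card (?G ` S) = card S"
    using span card_S_eq card_image_le[OF finite_S, of ?G]
    by (metis antisym dim_UNIV dim_le_card finite_S finite_imageI order_refl)
  then have inj: "inj_on ?G S"
    using finite_S by (rule eq_card_imp_inj_on[rotated])
  have "independent (?G ` S)"
    using span card_S_eq \<open>card (?G ` S) = card S\<close> finite_S
    by (intro card_le_dim_spanning[of _ UNIV]) auto
  \<comment> \<open>The functional takes the required values on the basis of gradients; the vector
    \<open>adjoint \<phi> 1\<close> representing it through the inner product is the step.\<close>
  then obtain \<phi> :: "'a \<Rightarrow> real" where "linear \<phi>"
    and \<phi>: "\<And>y. y \<in> ?G ` S \<Longrightarrow> \<phi> y = - f (inv_into S ?G y) x"
    using linear_independent_extend[of "?G ` S" "\<lambda>y. - f (inv_into S ?G y) x"] by blast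
  have "f a x + gradient (f a) x \<bullet> adjoint \<phi> 1 = 0" if "a \<in> S" for a
    using \<phi>[of "?G a"] adjoint_works[OF \<open>linear \<phi>\<close>, of "?G a" 1] inv_into_f_f[OF inj that] that
    by simp
  then show ?thesis using that unfolding newton_step_def by blast
qed

text \<open>Since \<open>f a p = 0\<close>, the Newton equation makes
  \<open>gradient (f a) x \<bullet> (x + d - p)\<close> equal to the linearization error of
  \<open>f a\<close> from \<open>x\<close> to \<open>p\<close>, which is
  \<open>o(norm (x - p))\<close>. The slope bound turns this into a bound on
  \<open>x + d - p\<close>.\<close>

lemma newton_step_superlinear:
  assumes "e > 0"
  shows "\<forall>\<^sub>F x in nhds p. \<exists>d. newton_step x d \<and> norm (x + d - p) \<le> e * norm (x - p)"
proof -
  obtain \<kappa> where "\<kappa> > 0"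
    and \<kappa>: "\<forall>\<^sub>F x in nhds p. \<forall>v. \<kappa> * norm v \<le> (\<Sum>a\<in>S. c a * \<bar>gradient (f a) x \<bullet> v\<bar>)"
    using sharp_gradients by blast
  \<comment> \<open>The summand \<open>1\<close> makes \<open>C'\<close> positive without inspecting
    the sum, and \<open>e'\<close> below is chosen so that
    \<open>C' * e' = \<kappa> * e\<close>.\<close>
  define C' where "C' = 1 + (\<Sum>a\<in>S. c a)"
  have C': "C' > 0"
    unfolding C'_def using c_pos by (intro add_pos_nonneg sum_nonneg) (auto simp: less_imp_le)
  define e' where "e' = e * \<kappa> / C'"
  have e': "e' > 0" using assms \<open>\<kappa> > 0\<close> C' by (simp add: e'_def)
  have "\<forall>\<^sub>F x in nhds p. \<bar>f a p - (f a x + gradient (f a) x \<bullet> (p - x))\<bar> \<le> e' * norm (p - x)"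
    if a: "a \<in> S" for a
  proof -
    obtain \<delta> where \<delta>: "\<delta> > 0" "\<And>x y. x \<in> ball p \<delta> \<Longrightarrow> y \<in> ball p \<delta> \<Longrightarrow>
       \<bar>f a y - (f a x + gradient (f a) x \<bullet> (y - x))\<bar> \<le> e' * norm (y - x)"
      using continuously_differentiable_strict[OF f_diff_S[OF a] e', of p] by metis
    then show ?thesis
      unfolding eventually_nhds_metric
      by (metis centre_in_ball dist_commute mem_ball)
  qed
  then have "\<forall>\<^sub>F x in nhds p. \<forall>a\<in>S.
      \<bar>f a p - (f a x + gradient (f a) x \<bullet> (p - x))\<bar> \<le> e' * norm (p - x)"
    by (intro eventually_ball_finite finite_S) auto
  with \<kappa> show ?thesis
  proof eventually_elim
    case (elim x)
    then obtain d where d: "newton_step x d"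
      using newton_step_exists \<open>\<kappa> > 0\<close> by metis
    have "\<kappa> * norm (x + d - p) \<le> (\<Sum>a\<in>S. c a * \<bar>gradient (f a) x \<bullet> (x + d - p)\<bar>)"
      using elim(1) by blast
    also have "\<dots> \<le> (\<Sum>a\<in>S. c a * (e' * norm (x - p)))"
    proof (intro sum_mono mult_left_mono)
      fix a assume a: "a \<in> S"
      then have "f a x + gradient (f a) x \<bullet> d = 0" using d by (simp add: newton_step_def)
      moreover have "f a p = 0" using active[OF a] .
      ultimately have "gradient (f a) x \<bullet> (x + d - p) =
          f a p - (f a x + gradient (f a) x \<bullet> (p - x))"
        by (simp add: inner_diff_right inner_add_right)
      then show "\<bar>gradient (f a) x \<bullet> (x + d - p)\<bar> \<le> e' * norm (x - p)"
        using elim(2) a by (metis norm_minus_commute)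
    qed (use c_pos less_imp_le in blast)
    also have "\<dots> = (C' - 1) * (e' * norm (x - p))"
      by (simp add: C'_def sum_distrib_right)
    also have "\<dots> \<le> C' * (e' * norm (x - p))"
      using e' by (intro mult_right_mono) auto
    also have "\<dots> = \<kappa> * (e * norm (x - p))"
      using C' by (simp add: e'_def)
    finally have "norm (x + d - p) \<le> e * norm (x - p)"
      using \<open>\<kappa> > 0\<close> by simp
    with d show ?case by blast
  qed
qed

section \<open>Growth and accuracy of the linearised penalty\<close>

text \<open>At a Newton step every active term sits at its kink, so \<open>w_growth\<close> applies.
  Inactive linearised constraints stay negative near \<open>(p, 0)\<close>, where their terms are
  minimal. The remaining linear terms are those of the second bound in
  \<open>sharp_gradients\<close>. The comparison point \<open>d'\<close> is unrestricted.\<close>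

lemma model_growth:
  obtains \<kappa> \<delta> where "\<kappa> > 0" "\<delta> > 0"
    "\<And>x d d'. \<lbrakk>dist x p < \<delta>; norm d < \<delta>; newton_step x d\<rbrakk>
       \<Longrightarrow> model x d + \<kappa> * norm (d' - d) \<le> model x d'"
proof -
  obtain \<kappa> where "\<kappa> > 0"
    and \<kappa>: "\<forall>\<^sub>F x in nhds p. \<forall>v. \<kappa> * norm v \<le> gradient f0 x \<bullet> v +
       (\<Sum>a\<in>S. m a * (gradient (f a) x \<bullet> v) + c a * \<bar>gradient (f a) x \<bullet> v\<bar>)"
    by (rule sharp_gradients)
  \<comment> \<open>The product filter treats base point and step jointly; it is split into separate
    neighbourhoods of \<open>p\<close> and \<open>0\<close> afterwards.\<close>
  have "\<forall>\<^sub>F xd in nhds p \<times>\<^sub>F nhds 0. f a (fst xd) + gradient (f a) (fst xd) \<bullet> snd xd < 0"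
    if a: "a \<in> A - S" for a
  proof -
    have "((\<lambda>xd. f a (fst xd)) \<longlongrightarrow> f a p) (nhds p \<times>\<^sub>F nhds (0::'a))"
      using filterlim_compose[OF continuously_differentiable_tendsto filterlim_fst] a f_diff by blast
    moreover have "((\<lambda>xd. gradient (f a) (fst xd)) \<longlongrightarrow> gradient (f a) p) (nhds p \<times>\<^sub>F nhds (0::'a))"
      using filterlim_compose[OF continuously_differentiable_tendsto_gradient filterlim_fst] a f_diff
      by blast
    ultimately have "((\<lambda>xd. f a (fst xd) + gradient (f a) (fst xd) \<bullet> snd xd) \<longlongrightarrow>
        f a p + gradient (f a) p \<bullet> 0) (nhds p \<times>\<^sub>F nhds 0)"
      by (intro tendsto_add tendsto_inner filterlim_snd)
    then show ?thesis
      using inactive[OF a] by (intro order_tendstoD(2)) auto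
  qed
  then have "\<forall>\<^sub>F xd in nhds p \<times>\<^sub>F nhds 0.
      \<forall>a\<in>A - S. f a (fst xd) + gradient (f a) (fst xd) \<bullet> snd xd < 0"
    using finite_A by (intro eventually_ball_finite) auto
  then obtain Q R where "eventually Q (nhds p)" "eventually R (nhds 0)"
    and QR: "\<And>x d a. \<lbrakk>Q x; R d; a \<in> A - S\<rbrakk> \<Longrightarrow> f a x + gradient (f a) x \<bullet> d < 0"
    unfolding eventually_prod_filter by auto
  obtain \<delta>1 where "\<delta>1 > 0" and Q: "\<And>x. dist x p < \<delta>1 \<Longrightarrow> Q x \<and> (\<forall>v. \<kappa> * norm v \<le> gradient f0 x \<bullet> v +
       (\<Sum>a\<in>S. m a * (gradient (f a) x \<bullet> v) + c a * \<bar>gradient (f a) x \<bullet> v\<bar>))"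
    using eventually_conj[OF \<open>eventually Q (nhds p)\<close> \<kappa>] unfolding eventually_nhds_metric by blast
  obtain \<delta>2 where "\<delta>2 > 0" and R: "\<And>d. norm d < \<delta>2 \<Longrightarrow> R d"
    using \<open>eventually R (nhds 0)\<close> unfolding eventually_nhds_metric by (metis dist_0_norm dist_commute)
  show ?thesis
  proof (rule that[of \<kappa> "min \<delta>1 \<delta>2"])
    fix x d d' :: 'a
    assume x: "dist x p < min \<delta>1 \<delta>2" and d: "norm d < min \<delta>1 \<delta>2" and newton: "newton_step x d"
    \<comment> \<open>The zero for inactive indices gives one inequality that can be summed over all
      of \<open>A\<close>.\<close>
    have "w a (f a x + gradient (f a) x \<bullet> d) +
        (if a \<in> S then m a * (gradient (f a) x \<bullet> (d' - d)) + c a * \<bar>gradient (f a) x \<bullet> (d' - d)\<bar> else 0)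
      \<le> w a (f a x + gradient (f a) x \<bullet> d')" if a: "a \<in> A" for a
    proof (cases "a \<in> S")
      case True
      then have 0: "f a x + gradient (f a) x \<bullet> d = 0" using newton by (simp add: newton_step_def)
      then have "f a x + gradient (f a) x \<bullet> d' = gradient (f a) x \<bullet> (d' - d)"
        by (simp add: inner_diff_right)
      then show ?thesis
        using w_growth[OF True, of "gradient (f a) x \<bullet> (d' - d)"] True 0 by simp
    next
      case False
      then have "f a x + gradient (f a) x \<bullet> d \<le> 0"
        using QR[of x d a] Q[of x] R[of d] x d a by auto
      then show ?thesis using w_inactive[of a] False a by simp
    qed
    then have "(\<Sum>a\<in>A. w a (f a x + gradient (f a) x \<bullet> d) +
        (if a \<in> S then m a * (gradient (f a) x \<bullet> (d' - d)) + c a * \<bar>gradient (f a) x \<bullet> (d' - d)\<bar> else 0))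
      \<le> (\<Sum>a\<in>A. w a (f a x + gradient (f a) x \<bullet> d'))"
      by (intro sum_mono)
    moreover have "(\<Sum>a\<in>A. if a \<in> S then m a * (gradient (f a) x \<bullet> (d' - d)) + c a * \<bar>gradient (f a) x \<bullet> (d' - d)\<bar> else 0)
      = (\<Sum>a\<in>S. m a * (gradient (f a) x \<bullet> (d' - d)) + c a * \<bar>gradient (f a) x \<bullet> (d' - d)\<bar>)"
      using S_subset finite_A by (subst sum.inter_restrict[symmetric]) (auto simp: inf_absorb2)
    moreover have "\<kappa> * norm (d' - d) \<le> gradient f0 x \<bullet> (d' - d) +
      (\<Sum>a\<in>S. m a * (gradient (f a) x \<bullet> (d' - d)) + c a * \<bar>gradient (f a) x \<bullet> (d' - d)\<bar>)"
      using Q[of x] x by simp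
    ultimately show "model x d + \<kappa> * norm (d' - d) \<le> model x d'"
      unfolding model_def by (simp add: sum.distrib inner_diff_right)
  qed (use \<open>\<kappa> > 0\<close> \<open>\<delta>1 > 0\<close> \<open>\<delta>2 > 0\<close> in auto)
qed

text \<open>The outer functions \<open>w a\<close> are Lipschitz, so the error reduces to the
  linearization errors of the inner functions. In \<open>C'\<close> the summand \<open>1\<close>
  accounts for \<open>f0\<close>, and \<open>C' * e' = e\<close>.\<close>

lemma model_error:
  assumes "e > 0"
  obtains \<delta> where "\<delta> > 0"
    "\<And>x d. x \<in> ball p \<delta> \<Longrightarrow> x + d \<in> ball p \<delta> \<Longrightarrow> \<bar>merit (x + d) - model x d\<bar> \<le> e * norm d"
proof -
  define C' where "C' = 1 + (\<Sum>a\<in>A. C a)"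
  have C': "C' > 0"
    unfolding C'_def using C_nonneg by (intro add_pos_nonneg sum_nonneg) auto
  define e' where "e' = e / C'"
  have e': "e' > 0" using assms C' by (simp add: e'_def)
  have "\<exists>\<delta>>0. \<forall>x\<in>ball p \<delta>. \<forall>y\<in>ball p \<delta>.
      \<bar>f a y - (f a x + gradient (f a) x \<bullet> (y - x))\<bar> \<le> e' * norm (y - x)" if "a \<in> A" for a
    by (rule continuously_differentiable_strict[OF f_diff[OF that] e', of p]) blast
  then have "\<forall>a\<in>A. \<exists>\<delta>. \<delta> > 0 \<and> (\<forall>x\<in>ball p \<delta>. \<forall>y\<in>ball p \<delta>.
      \<bar>f a y - (f a x + gradient (f a) x \<bullet> (y - x))\<bar> \<le> e' * norm (y - x))"
    by blast
  from bchoice[OF this] obtain \<delta> where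
    \<delta>: "\<forall>a\<in>A. \<delta> a > 0 \<and> (\<forall>x\<in>ball p (\<delta> a). \<forall>y\<in>ball p (\<delta> a).
      \<bar>f a y - (f a x + gradient (f a) x \<bullet> (y - x))\<bar> \<le> e' * norm (y - x))" ..
  obtain \<delta>0 where \<delta>0: "\<delta>0 > 0" "\<And>x y. x \<in> ball p \<delta>0 \<Longrightarrow> y \<in> ball p \<delta>0 \<Longrightarrow>
      \<bar>f0 y - (f0 x + gradient f0 x \<bullet> (y - x))\<bar> \<le> e' * norm (y - x)"
    by (rule continuously_differentiable_strict[OF f0_diff e', of p]) blast
  define \<delta>' where "\<delta>' = Min (insert \<delta>0 (\<delta> ` A))"
  have "\<delta>' \<le> \<delta>0" and le: "\<And>a. a \<in> A \<Longrightarrow> \<delta>' \<le> \<delta> a"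
    unfolding \<delta>'_def using finite_A by auto
  show ?thesis
  proof (rule that[of \<delta>'])
    show "\<delta>' > 0" unfolding \<delta>'_def using finite_A \<delta> \<delta>0(1) by simp
    fix x d assume x: "x \<in> ball p \<delta>'" and y: "x + d \<in> ball p \<delta>'"
    have "\<bar>w a (f a (x + d)) - w a (f a x + gradient (f a) x \<bullet> d)\<bar> \<le> C a * (e' * norm d)"
      if a: "a \<in> A" for a
    proof -
      have "\<bar>f a (x + d) - (f a x + gradient (f a) x \<bullet> d)\<bar> \<le> e' * norm d"
        using \<delta>[rule_format, OF a, THEN conjunct2, rule_format, of x "x + d"] x y le[OF a] by simp
      then show ?thesis
        using w_lipschitz[OF a] C_nonneg[OF a] by (meson mult_left_mono order_trans)
    qed
    then have "\<bar>\<Sum>a\<in>A. w a (f a (x + d)) - w a (f a x + gradient (f a) x \<bullet> d)\<bar> \<le>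
        (\<Sum>a\<in>A. C a * (e' * norm d))"
      by (intro order_trans[OF sum_abs] sum_mono)
    moreover have "\<bar>f0 (x + d) - (f0 x + gradient f0 x \<bullet> d)\<bar> \<le> e' * norm d"
      using \<delta>0(2)[of x "x + d"] x y \<open>\<delta>' \<le> \<delta>0\<close> by simp
    ultimately have "\<bar>merit (x + d) - model x d\<bar> \<le> e' * norm d + (\<Sum>a\<in>A. C a * (e' * norm d))"
      unfolding merit_def model_def sum_subtractf by linarith
    also have "\<dots> = C' * (e' * norm d)"
      by (simp add: C'_def sum_distrib_right distrib_right)
    also have "\<dots> = e * norm d" using C' by (simp add: e'_def)
    finally show "\<bar>merit (x + d) - model x d\<bar> \<le> e * norm d" .
  qed
qed

text \<open>Collects what one iteration needs at a fixed \<open>x\<close>, uniformly over all radii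
  at least \<open>r0\<close>. The ratio test is stated as a product because the predicted decrease
  vanishes when \<open>d = 0\<close>.\<close>

lemma eventually_trust_region_newton:
  assumes e: "e > 0" and rho: "rho < 1" and r0: "r0 > 0"
  shows "\<forall>\<^sub>F x in nhds p. \<exists>d. norm (x + d - p) \<le> e * norm (x - p) \<and>
    (\<forall>r\<ge>r0. \<forall>d'. is_arg_min (model x) (\<lambda>d. norm d \<le> r) d' \<longrightarrow> d' = d) \<and>
    0 \<le> merit x - model x d \<and>
    rho * (merit x - model x d) \<le> merit x - merit (x + d)"
proof -
  obtain \<kappa> \<delta>1 where "\<kappa> > 0" "\<delta>1 > 0" and growth:
    "\<And>x d d'. \<lbrakk>dist x p < \<delta>1; norm d < \<delta>1; newton_step x d\<rbrakk>
       \<Longrightarrow> model x d + \<kappa> * norm (d' - d) \<le> model x d'"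
    using model_growth by blast
  \<comment> \<open>With a predicted decrease of at least \<open>\<kappa> * norm d\<close>, this
    tolerance keeps the model error below the fraction \<open>1 - rho\<close> of it.\<close>
  have "\<kappa> * (1 - rho) > 0" using \<open>\<kappa> > 0\<close> rho by simp
  then obtain \<delta>2 where "\<delta>2 > 0" and error: "\<And>x d. x \<in> ball p \<delta>2 \<Longrightarrow> x + d \<in> ball p \<delta>2 \<Longrightarrow>
      \<bar>merit (x + d) - model x d\<bar> \<le> \<kappa> * (1 - rho) * norm d"
    using model_error by blast
  \<comment> \<open>Halved because \<open>d\<close> is the difference of \<open>x + d - p\<close>
    and \<open>x - p\<close>, both shorter than \<open>\<delta>\<close>; thus
    \<open>norm d < 2 * \<delta>\<close>, and \<open>d\<close> lies in every trust region
    considered.\<close>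
  define \<delta> where "\<delta> = min (min \<delta>1 \<delta>2) r0 / 2"
  have \<delta>: "\<delta> > 0" "2 * \<delta> \<le> \<delta>1" "2 * \<delta> \<le> \<delta>2" "2 * \<delta> \<le> r0"
    using \<open>\<delta>1 > 0\<close> \<open>\<delta>2 > 0\<close> r0 by (auto simp: \<delta>_def)
  have "\<forall>\<^sub>F x in nhds p. dist x p < \<delta>"
    using \<delta>(1) by (auto simp: eventually_nhds_metric)
  \<comment> \<open>The cap \<open>1\<close> keeps \<open>x + d\<close> as close to \<open>p\<close>
    as \<open>x\<close> even when \<open>e\<close> is large.\<close>
  moreover have "\<forall>\<^sub>F x in nhds p. \<exists>d. newton_step x d \<and> norm (x + d - p) \<le> min e 1 * norm (x - p)"
    using e by (intro newton_step_superlinear) simp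
  ultimately show ?thesis
  proof eventually_elim
    case (elim x)
    then obtain d where newton: "newton_step x d"
      and contract: "norm (x + d - p) \<le> min e 1 * norm (x - p)" by blast
    have le_e: "norm (x + d - p) \<le> e * norm (x - p)"
      using contract by (meson min.cobounded1 mult_right_mono norm_ge_zero order_trans)
    have "norm (x + d - p) \<le> 1 * norm (x - p)"
      using contract by (meson min.cobounded2 mult_right_mono norm_ge_zero order_trans)
    then have y: "norm (x + d - p) < \<delta>" and x: "norm (x - p) < \<delta>"
      using elim(1) by (auto simp: dist_norm)
    have d: "norm d < 2 * \<delta>"
      using norm_triangle_ineq4[of "x + d - p" "x - p"] x y by simp
    have min: "model x d + \<kappa> * norm (d' - d) \<le> model x d'" for d'
      using elim(1) d \<delta> newton by (intro growth) auto
    \<comment> \<open>Comparing \<open>d\<close> with the zero step turns the growth bound into a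
      lower bound on the predicted decrease.\<close>
    have "model x 0 = merit x" by (simp add: model_def merit_def)
    then have pred: "\<kappa> * norm d \<le> merit x - model x d"
      using min[of 0] by simp
    have err: "\<bar>merit (x + d) - model x d\<bar> \<le> \<kappa> * (1 - rho) * norm d"
      using x y \<delta> by (intro error) (auto simp: dist_norm norm_minus_commute)
    have "d' = d" if "r \<ge> r0" "is_arg_min (model x) (\<lambda>d. norm d \<le> r) d'" for r d'
    proof -
      have "model x d' \<le> model x d"
        using that d \<delta>(4) by (auto simp: is_arg_min_linorder)
      then have "\<kappa> * norm (d' - d) \<le> 0" using min[of d'] by simp
      then show ?thesis using \<open>\<kappa> > 0\<close> by (simp add: mult_le_0_iff)
    qed
    moreover have "0 \<le> merit x - model x d"
      using pred \<open>\<kappa> > 0\<close> by (meson less_imp_le mult_nonneg_nonneg norm_ge_zero order_trans)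
    moreover have "rho * (merit x - model x d) \<le> merit x - merit (x + d)"
    proof -
      have "(1 - rho) * (\<kappa> * norm d) \<le> (1 - rho) * (merit x - model x d)"
        using pred rho by (intro mult_left_mono) auto
      then show ?thesis using err by (simp add: algebra_simps)
    qed
    ultimately show ?case using le_e by blast
  qed
qed

end

section \<open>The optimal control problem as a sharp vertex\<close>

lemma I_eq_I_ineq_disjoint: "I_eq P \<inter> I_ineq P = {}"
  by (auto simp: I_eq_def I_ineq_def)

lemma finite_indices [simp]: "finite (I_eq P)" "finite (I_ineq P)" "finite (J_ineq P)"
  by (simp_all add: I_eq_def I_ineq_def J_ineq_def)

lemma finite_active [simp]: "finite (I_ac P zb)" "finite (J_ac P zb)"
  by (simp_all add: I_ac_def J_ac_def)

definition penalty_term ::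
    "('n::finite) ocp \<Rightarrow> (nat \<Rightarrow> real) \<Rightarrow> (nat \<Rightarrow> real) \<Rightarrow> nat + nat \<Rightarrow> real \<Rightarrow> real" where
  "penalty_term P lam \<tau> =
     case_sum (\<lambda>i t. if i \<in> I_eq P then lam i * \<bar>t\<bar> else lam i * max 0 t) (\<lambda>j t. \<tau> j * max 0 t)"

text \<open>Distance of the multiplier from the two one-sided slopes of the penalty term at
  \<open>0\<close>: these are \<open>- lam i\<close> and \<open>lam i\<close> for an equality,
  \<open>0\<close> and the weight for an inequality. Strict complementarity makes the distance to
  \<open>0\<close> positive.\<close>

definition growth_rate ::
    "('n::finite) ocp \<Rightarrow> (nat \<Rightarrow> real) \<Rightarrow> (nat \<Rightarrow> real) \<Rightarrow> (nat \<Rightarrow> real) \<Rightarrow> (nat \<Rightarrow> real) \<Rightarrow>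
     nat + nat \<Rightarrow> real" where
  "growth_rate P lam \<tau> \<mu> \<sigma> =
     case_sum (\<lambda>i. if i \<in> I_eq P then lam i - \<bar>\<mu> i\<bar> else min (\<mu> i) (lam i - \<mu> i))
       (\<lambda>j. min (\<sigma> j) (\<tau> j - \<sigma> j))"

abbreviation constraint :: "('n::finite) ocp \<Rightarrow> nat + nat \<Rightarrow> real^'n \<Rightarrow> real" where
  "constraint P \<equiv> case_sum (gfun P) (hfun P)"

lemma sum_constraints:
  fixes F :: "nat + nat \<Rightarrow> 'b::comm_monoid_add"
  assumes "finite I" "I \<subseteq> I_ineq P" "finite J"
  shows "sum F ((I_eq P \<union> I) <+> J) =
    (\<Sum>i\<in>I_eq P. F (Inl i)) + (\<Sum>i\<in>I. F (Inl i)) + (\<Sum>j\<in>J. F (Inr j))"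
proof -
  have "I_eq P \<inter> I = {}" using assms(2) I_eq_I_ineq_disjoint by blast
  then show ?thesis
    using assms by (simp add: sum.Plus sum.union_disjoint)
qed

text \<open>\<open>F\<close> is left general so that the identity covers both the constraint values
  and their linearizations.\<close>

lemma composite_penalty:
  "(\<Sum>i\<in>I_eq P. lam i * \<bar>F (Inl i)\<bar>) + (\<Sum>i\<in>I_ineq P. lam i * max 0 (F (Inl i))) +
      (\<Sum>j\<in>J_ineq P. \<tau> j * max 0 (F (Inr j))) =
    (\<Sum>a\<in>(I_eq P \<union> I_ineq P) <+> J_ineq P. penalty_term P lam \<tau> a (F a))"
proof -
  have "(\<Sum>i\<in>I_ineq P. lam i * max 0 (F (Inl i))) =
      (\<Sum>i\<in>I_ineq P. penalty_term P lam \<tau> (Inl i) (F (Inl i)))"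
    using I_eq_I_ineq_disjoint[of P] by (intro sum.cong) (auto simp: penalty_term_def)
  then show ?thesis
    by (subst sum_constraints) (simp_all add: penalty_term_def)
qed

lemma max_zero_growth:
  fixes l m t :: real
  shows "m * t + min m (l - m) * \<bar>t\<bar> \<le> l * max 0 t"
proof (cases "t \<ge> 0")
  case True
  then have "min m (l - m) * t \<le> (l - m) * t" by (intro mult_right_mono) auto
  with True show ?thesis by (simp add: algebra_simps)
next
  case False
  then have "min m (l - m) * (- t) \<le> m * (- t)" by (intro mult_right_mono) auto
  with False show ?thesis by simp
qed

lemma abs_growth:
  fixes l m t :: real
  shows "m * t + (l - \<bar>m\<bar>) * \<bar>t\<bar> \<le> l * \<bar>t\<bar>"
  using abs_ge_self[of "m * t"] by (simp add: abs_mult algebra_simps)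

lemma penalty_term_lipschitz:
  assumes "case_sum lam \<tau> a \<ge> 0"
  shows "\<bar>penalty_term P lam \<tau> a s - penalty_term P lam \<tau> a t\<bar> \<le> case_sum lam \<tau> a * \<bar>s - t\<bar>"
proof -
  have "\<bar>l * u - l * v\<bar> \<le> l * \<bar>s - t\<bar>" if "l \<ge> 0" "\<bar>u - v\<bar> \<le> \<bar>s - t\<bar>" for l u v
    using that by (metis abs_mult abs_of_nonneg mult_left_mono right_diff_distrib)
  moreover have "\<bar>\<bar>s\<bar> - \<bar>t\<bar>\<bar> \<le> \<bar>s - t\<bar>" "\<bar>max 0 s - max 0 t\<bar> \<le> \<bar>s - t\<bar>" by linarith+
  ultimately show ?thesis
    using assms by (auto simp: penalty_term_def split: sum.split)
qed

text \<open>LICQ supplies the independence, strict complementarity the stationarity and, with the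
  strict weight bounds, the positive growth rates; the binding assumption supplies the
  count.\<close>

lemma sharp_vertex_ocp:
  fixes P :: "('n::finite) ocp"
  assumes valid: "valid_ocp P" and licq: "licq P zb"
    and scs: "strict_complementary_slackness P zb \<mu> \<sigma>" and binding: "binding P zb"
    and lam: "\<And>i. i \<in> I_eq P \<union> I_ineq P \<Longrightarrow> lam i > \<bar>\<mu> i\<bar>"
    and tau: "\<And>j. j \<in> J_ineq P \<Longrightarrow> \<tau> j > \<bar>\<sigma> j\<bar>"
  shows "sharp_vertex (gfun P 0) (constraint P) (penalty_term P lam \<tau>)
    ((I_eq P \<union> I_ineq P) <+> J_ineq P) ((I_eq P \<union> I_ac P zb) <+> J_ac P zb)
    (case_sum \<mu> \<sigma>) (growth_rate P lam \<tau> \<mu> \<sigma>) (case_sum lam \<tau>) zb"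
    (is "sharp_vertex _ _ _ ?A ?S _ _ _ _")
proof
  have I_ac: "I_ac P zb \<subseteq> I_ineq P" and J_ac: "J_ac P zb \<subseteq> J_ineq P"
    by (auto simp: I_ac_def J_ac_def)
  have not_eq: "i \<notin> I_eq P" if "i \<in> I_ineq P" for i
    using that I_eq_I_ineq_disjoint by blast
  have feasible: "zb \<in> feasible P"
    using scs by (simp add: strict_complementary_slackness_def local_optimum_def)
  have gradients: "case_sum (\<lambda>i. gradient (gfun P i) zb) (\<lambda>j. gradient (hfun P j) zb) =
      (\<lambda>a. gradient (constraint P a) zb)"
    by (auto simp: fun_eq_iff split: sum.split)
  have pos: "case_sum lam \<tau> a \<ge> 0" if "a \<in> ?A" for a
    using that lam tau by (fastforce intro: order_trans[OF abs_ge_zero less_imp_le])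
  show "finite ?A" by simp
  show "?S \<subseteq> ?A" using I_ac J_ac by blast
  show "continuously_differentiable (gfun P 0)"
    using valid by (simp add: valid_ocp_def)
  show "continuously_differentiable (constraint P a)" if "a \<in> ?A" for a
    using that valid by (auto simp: valid_ocp_def)
  show "constraint P a zb = 0" if "a \<in> ?S" for a
    using that feasible by (auto simp: feasible_def I_ac_def J_ac_def)
  show "constraint P a zb < 0" if "a \<in> ?A - ?S" for a
    using that feasible by (force simp: feasible_def I_ac_def J_ac_def)
  show "\<bar>penalty_term P lam \<tau> a s - penalty_term P lam \<tau> a t\<bar> \<le> case_sum lam \<tau> a * \<bar>s - t\<bar>"
    if "a \<in> ?A" for a s t
    by (rule penalty_term_lipschitz[OF pos[OF that]])
  show "case_sum lam \<tau> a \<ge> 0" if "a \<in> ?A" for a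
    by (rule pos[OF that])
  show "growth_rate P lam \<tau> \<mu> \<sigma> a > 0" if "a \<in> ?S" for a
  proof -
    have "\<mu> i > 0 \<and> lam i - \<mu> i > 0" if "i \<in> I_ac P zb" for i
      using that scs lam[of i] I_ac by (auto simp: strict_complementary_slackness_def)
    moreover have "\<sigma> j > 0 \<and> \<tau> j - \<sigma> j > 0" if "j \<in> J_ac P zb" for j
      using that scs tau[of j] J_ac by (auto simp: strict_complementary_slackness_def)
    ultimately show ?thesis
      using that lam by (auto simp: growth_rate_def)
  qed
  show "penalty_term P lam \<tau> a 0 + case_sum \<mu> \<sigma> a * t + growth_rate P lam \<tau> \<mu> \<sigma> a * \<bar>t\<bar>
      \<le> penalty_term P lam \<tau> a t" if "a \<in> ?S" for a t
    using max_zero_growth abs_growth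
    by (cases a) (auto simp: penalty_term_def growth_rate_def)
  \<comment> \<open>Equalities all belong to the active set, so only terms with \<open>max 0\<close>
    occur here, and these vanish at \<open>s \<le> 0\<close>.\<close>
  show "penalty_term P lam \<tau> a s \<le> penalty_term P lam \<tau> a t" if "a \<in> ?A - ?S" "s \<le> 0" for a s t
    using that pos[of a] by (cases a) (auto simp: penalty_term_def)
  have "gradient (gfun P 0) zb + ((\<Sum>i\<in>I_eq P. \<mu> i *\<^sub>R gradient (gfun P i) zb) +
      (\<Sum>i\<in>I_ac P zb. \<mu> i *\<^sub>R gradient (gfun P i) zb) +
      (\<Sum>j\<in>J_ac P zb. \<sigma> j *\<^sub>R gradient (hfun P j) zb)) = 0"
    using scs by (simp add: strict_complementary_slackness_def add.assoc)
  then show "gradient (gfun P 0) zb + (\<Sum>a\<in>?S. case_sum \<mu> \<sigma> a *\<^sub>R gradient (constraint P a) zb) = 0"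
    by (subst sum_constraints) (simp_all add: I_ac)
  show "inj_on (\<lambda>a. gradient (constraint P a) zb) ?S"
    and "independent ((\<lambda>a. gradient (constraint P a) zb) ` ?S)"
    using licq unfolding licq_def Let_def gradients by blast+
  \<comment> \<open>The bounds \<open>nx * horizon\<close> on the equalities and
    \<open>nu * (horizon - 1)\<close> on the active inequalities add up to the dimension.\<close>
  have "I_eq P \<inter> I_ac P zb = {}" using I_ac I_eq_I_ineq_disjoint by blast
  then have "card ?S = neq P + card (I_ac P zb) + card (J_ac P zb)"
    by (simp add: card_Plus card_Un_disjoint I_eq_def[of P])
  then show "card ?S \<ge> DIM(real^'n)"
    using valid binding by (simp add: valid_ocp_def binding_def)
qed

section \<open>Trust-region iterations and superlinear convergence\<close>

text \<open>The first rejection would have to occur at radius \<open>r\<close> itself, where every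
  solution passes the test.\<close>

lemma scvx_radius_unchanged:
  assumes "scvx_radius P lam \<tau> A x r s"
    and "\<And>d. \<lbrakk>subproblem_solution P lam \<tau> x r d; predicted_decrease P lam \<tau> x d \<noteq> 0\<rbrakk>
      \<Longrightarrow> rho0 A \<le> decrease_ratio P lam \<tau> x d"
  shows "s = r"
  using assms by (induction) (auto simp: not_le[symmetric])

lemma scvx_accept_radius_ge: "scvx_accept P lam \<tau> A x r x' r' \<Longrightarrow> rl A \<le> r'"
  by (auto simp: scvx_accept_def updated_radius_def)

lemma scvx_accept_step:
  assumes accept: "scvx_accept P lam \<tau> A x r x' r'"
    and unique: "\<And>d'. subproblem_solution P lam \<tau> x r d' \<Longrightarrow> d' = d"
    and pred: "0 \<le> predicted_decrease P lam \<tau> x d"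
    and ratio: "rho0 A * predicted_decrease P lam \<tau> x d \<le> actual_decrease P lam \<tau> x d"
  shows "x' = x + d"
proof -
  \<comment> \<open>A nonzero predicted decrease is positive here, so the product form of the test
    may be divided by it.\<close>
  have no_reject: "rho0 A \<le> decrease_ratio P lam \<tau> x d'"
    if "subproblem_solution P lam \<tau> x r d'" "predicted_decrease P lam \<tau> x d' \<noteq> 0" for d'
    using that unique pred ratio by (auto simp: decrease_ratio_def le_divide_eq)
  from accept obtain s d' where "scvx_radius P lam \<tau> A x r s"
    and "subproblem_solution P lam \<tau> x s d'" and "x' = x + d'"
    unfolding scvx_accept_def by blast
  then show ?thesis
    using scvx_radius_unchanged[OF _ no_reject] unique by metis
qed

theorem theorem4p7:
  fixes P :: "('n::finite) ocp"
    and lam \<tau> \<mu> \<sigma> :: "nat \<Rightarrow> real"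
    and A :: scvx_params
    and Z :: "(real^'n) set"
    and z :: "nat \<Rightarrow> real^'n"
    and zb :: "real^'n"
  assumes "valid_ocp P"
    and "\<And>i. i \<in> I_eq P \<union> I_ineq P \<Longrightarrow> lam i \<ge> 0"
    and "\<And>j. j \<in> J_ineq P \<Longrightarrow> \<tau> j \<ge> 0"
    and "valid_params A"
    and "convex Z" and "compact Z"
    and "scvx_sequence P lam \<tau> A z"
    and "\<And>k. k \<ge> 1 \<Longrightarrow> z k \<in> Z"
    and "z \<longlonglongrightarrow> zb"
    and "licq P zb"
    and "strict_complementary_slackness P zb \<mu> \<sigma>"
    and "\<And>i. i \<in> I_eq P \<union> I_ineq P \<Longrightarrow> lam i > \<bar>\<mu> i\<bar>"
    and "\<And>j. j \<in> J_ineq P \<Longrightarrow> \<tau> j > \<bar>\<sigma> j\<bar>"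
    and "binding P zb"
  shows "(\<lambda>k. norm (z (Suc k) - zb)) \<in> o(\<lambda>k. norm (z k - zb))"
proof -
  let ?A = "(I_eq P \<union> I_ineq P) <+> J_ineq P"
  interpret vertex: sharp_vertex "gfun P 0" "constraint P" "penalty_term P lam \<tau>"
    ?A "(I_eq P \<union> I_ac P zb) <+> J_ac P zb"
    "case_sum \<mu> \<sigma>" "growth_rate P lam \<tau> \<mu> \<sigma>" "case_sum lam \<tau>" zb
    using assms by (intro sharp_vertex_ocp) auto
  have merit: "vertex.merit = penalty P lam \<tau>"
  proof
    show "vertex.merit x = penalty P lam \<tau> x" for x
      using composite_penalty[where F = "\<lambda>a. constraint P a x" and P = P and lam = lam and \<tau> = \<tau>]
      by (simp add: vertex.merit_def penalty_def)
  qed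
  have model: "vertex.model x = lin_penalty P lam \<tau> x" for x
  proof
    show "vertex.model x d = lin_penalty P lam \<tau> x d" for d
      using composite_penalty[where F = "\<lambda>a. constraint P a x + gradient (constraint P a) x \<bullet> d"
          and P = P and lam = lam and \<tau> = \<tau>]
      by (simp add: vertex.model_def lin_penalty_def linearization_def)
  qed
  obtain r where "(\<forall>k\<ge>1. scvx_accept P lam \<tau> A (z k) (r k) (z (Suc k)) (r (Suc k))) \<or>
      (\<exists>K. \<forall>l\<ge>K. z l = z K)"
    using assms(7) unfolding scvx_sequence_def by blast
  then show ?thesis
  proof
    assume "\<exists>K. \<forall>l\<ge>K. z l = z K"
    then obtain K where K: "\<And>l. l \<ge> K \<Longrightarrow> z l = z K" by blast
    then have "\<forall>\<^sub>F l in sequentially. z l = z K"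
      unfolding eventually_sequentially by blast
    then have "z \<longlonglongrightarrow> z K" by (rule tendsto_eventually)
    then have "z K = zb" using assms(9) LIMSEQ_unique by blast
    then have "norm (z (Suc k) - zb) = 0" if "k \<ge> K" for k
      using K[OF le_SucI[OF that]] by simp
    then show ?thesis
      \<comment> \<open>The error after the step is \<open>0\<close> from \<open>K\<close> on, so
        every inequality required for little-o holds without dividing by
        \<open>norm (z k - zb)\<close>.\<close>
      by (intro landau_o.smallI) (auto simp: eventually_sequentially intro!: exI[of _ K])
  next
    assume accept: "\<forall>k\<ge>1. scvx_accept P lam \<tau> A (z k) (r k) (z (Suc k)) (r (Suc k))"
    \<comment> \<open>The initial radius \<open>r 1\<close> is only known to be positive; the reset
      to at least \<open>rl A\<close> takes effect from index \<open>2\<close>.\<close>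
    have radius: "rl A \<le> r k" if k: "k \<ge> 2" for k
    proof -
      obtain j where "k = Suc j" "j \<ge> 1"
        using k by (cases k) auto
      then show ?thesis using accept scvx_accept_radius_ge by blast
    qed
    show ?thesis
    proof (rule landau_o.smallI)
      fix e :: real assume "e > 0"
      have "\<forall>\<^sub>F x in nhds zb. \<exists>d. norm (x + d - zb) \<le> e * norm (x - zb) \<and>
        (\<forall>r\<ge>rl A. \<forall>d'. subproblem_solution P lam \<tau> x r d' \<longrightarrow> d' = d) \<and>
        0 \<le> predicted_decrease P lam \<tau> x d \<and>
        rho0 A * predicted_decrease P lam \<tau> x d \<le> actual_decrease P lam \<tau> x d"
        using vertex.eventually_trust_region_newton[OF \<open>e > 0\<close>, of "rho0 A" "rl A"] assms(4)
        unfolding merit model subproblem_solution_def predicted_decrease_def actual_decrease_def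
          valid_params_def by simp
      then have "\<forall>\<^sub>F k in sequentially. \<exists>d. norm (z k + d - zb) \<le> e * norm (z k - zb) \<and>
        (\<forall>r\<ge>rl A. \<forall>d'. subproblem_solution P lam \<tau> (z k) r d' \<longrightarrow> d' = d) \<and>
        0 \<le> predicted_decrease P lam \<tau> (z k) d \<and>
        rho0 A * predicted_decrease P lam \<tau> (z k) d \<le> actual_decrease P lam \<tau> (z k) d"
        using assms(9) by (rule eventually_compose_filterlim)
      then show "\<forall>\<^sub>F k in sequentially. norm (norm (z (Suc k) - zb)) \<le> e * norm (norm (z k - zb))"
        using eventually_ge_at_top[of 2]
      proof eventually_elim
        case (elim k)
        then obtain d where contract: "norm (z k + d - zb) \<le> e * norm (z k - zb)"
          and unique: "\<And>d'. subproblem_solution P lam \<tau> (z k) (r k) d' \<Longrightarrow> d' = d"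
          and pred: "0 \<le> predicted_decrease P lam \<tau> (z k) d"
          and ratio: "rho0 A * predicted_decrease P lam \<tau> (z k) d \<le> actual_decrease P lam \<tau> (z k) d"
          using radius[of k] by blast
        have "scvx_accept P lam \<tau> A (z k) (r k) (z (Suc k)) (r (Suc k))"
          using accept elim(2) by simp
        then have "z (Suc k) = z k + d"
          using unique pred ratio by (rule scvx_accept_step)
        with contract show ?case by simp
      qed
    qed
  qed
qed

end
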